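(* Let $Q$ be a finite, connected, graded poset and let $k\ge 1$ be an integer. Then $$\mathcal{N}_{[k]\times Q}(x)=\sum_{I}\mathcal{N}_I^k(x),$$ where $I$ runs over all ideals of $Q$.
   Context: A finite poset is graded if all its maximal chains have the same length. $[k]$ denotes the chain with $k$ elements, and $[k]\times Q$ is the product poset with the componentwise order. For a finite poset $R$, $\mathcal{N}_R(x):=\sum_A x^{|A|}$, where $A$ runs over all antichains of $R$ (including the empty one). An ideal of $Q$ is a subset $I\subseteq Q$ such that $x\le y$ in $Q$ and $y\in I$ imply $x\in I$ (the empty set is an ideal). For an ideal $I$, $\max(I)$ denotes the set of maximal elements of $I$. For an ideal $I$ of $Q$ and an integer $k\ge 1$, define $$\mathcal{N}_I^k(x):=\sum_{I_1\subseteq\cdots\subseteq I_{k-1}\subseteq I_k=I} x^{\sum_{j=1}^k \#(\max(I_j)\setminus I_{j-1})},$$ where the sum runs over all increasing $(k-1)$-sequences $I_1\subseteq\cdots\subseteq I_{k-1}$ of ideals of $Q$ contained in $I$, with the conventions $I_k:=I$ and $I_0:=\emptyset$. *)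

theory Defs
  imports "HOL-Library.FuncSet" "HOL-Computational_Algebra.Polynomial"
begin

text \<open>A poset is a carrier set \<open>P\<close> together with a relation \<open>r\<close> such that
  \<^const>\<open>partial_order_on\<close> \<open>P r\<close>; the pair \<open>(x, y) \<in> r\<close> means \<open>x \<le> y\<close>.\<close>

text \<open>The length of a chain is one less than its cardinality, so equal lengths are
  expressed by equal cardinalities.\<close>

definition graded_poset :: "'a set \<Rightarrow> 'a rel \<Rightarrow> bool" where
  "graded_poset P r \<longleftrightarrow>
     (\<forall>C D. pred_on.maxchain P (\<lambda>x y. (x, y) \<in> r) C \<longrightarrow>
            pred_on.maxchain P (\<lambda>x y. (x, y) \<in> r) D \<longrightarrow> card C = card D)"

text \<open>Any two elements are joined by a sequence of successively comparable elements.
  The empty poset is not excluded.\<close>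

definition connected_poset :: "'a set \<Rightarrow> 'a rel \<Rightarrow> bool" where
  "connected_poset P r \<longleftrightarrow> (\<forall>x\<in>P. \<forall>y\<in>P. (x, y) \<in> (r \<union> r\<inverse>)\<^sup>*)"

definition chain_order :: "nat \<Rightarrow> nat rel" where
  "chain_order k = {(i, j). i \<in> {1..k} \<and> j \<in> {1..k} \<and> i \<le> j}"

definition product_order :: "'a rel \<Rightarrow> 'b rel \<Rightarrow> ('a \<times> 'b) rel" where
  "product_order r s = {((a, b), (c, d)). (a, c) \<in> r \<and> (b, d) \<in> s}"

definition antichains :: "'a set \<Rightarrow> 'a rel \<Rightarrow> 'a set set" where
  "antichains P r = {A. A \<subseteq> P \<and> (\<forall>x\<in>A. \<forall>y\<in>A. (x, y) \<in> r \<longrightarrow> x = y)}"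

definition antichain_poly :: "'a set \<Rightarrow> 'a rel \<Rightarrow> int poly" where
  "antichain_poly P r = (\<Sum>A\<in>antichains P r. monom 1 (card A))"

definition ideals :: "'a set \<Rightarrow> 'a rel \<Rightarrow> 'a set set" where
  "ideals P r = {I. I \<subseteq> P \<and> (\<forall>x\<in>P. \<forall>y\<in>I. (x, y) \<in> r \<longrightarrow> x \<in> I)}"

definition max_elems :: "'a rel \<Rightarrow> 'a set \<Rightarrow> 'a set" where
  "max_elems r I = {x \<in> I. \<forall>y\<in>I. (x, y) \<in> r \<longrightarrow> y = x}"

text \<open>An increasing sequence \<open>I\<^sub>1 \<subseteq> \<dots> \<subseteq> I\<^sub>k\<^sub>-\<^sub>1\<close> of ideals contained in \<open>I\<close> is encoded as
  the function \<open>F\<close> on \<open>{0..k}\<close> (undefined outside) that also records the conventions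
  \<open>F 0 = {}\<close> and \<open>F k = I\<close>.\<close>

definition ideal_seqs :: "'a set \<Rightarrow> 'a rel \<Rightarrow> nat \<Rightarrow> 'a set \<Rightarrow> (nat \<Rightarrow> 'a set) set" where
  "ideal_seqs P r k I =
     {F \<in> {0..k} \<rightarrow>\<^sub>E ideals P r. F 0 = {} \<and> F k = I \<and> (\<forall>j<k. F j \<subseteq> F (Suc j))}"

definition ideal_poly :: "'a set \<Rightarrow> 'a rel \<Rightarrow> nat \<Rightarrow> 'a set \<Rightarrow> int poly" where
  "ideal_poly P r k I =
     (\<Sum>F\<in>ideal_seqs P r k I. monom 1 (\<Sum>j=1..k. card (max_elems r (F j) - F (j - 1))))"

end

(* Antichains of [k] \<times> Q are the sets of maximal elements of the ideals of [k] \<times> Q.  Such an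
   ideal is a decreasing sequence of k ideals of Q (its fibres over 1, ..., k), which is read
   backwards as I_1 \<subseteq> ... \<subseteq> I_k, and (i, a) is maximal in it iff a is maximal in its fibre
   I_(k+1-i) and does not lie in the next fibre I_(k-i). *)
theory Submission
  imports Defs
begin

text \<open>The last member \<open>F k\<close> is left free: this is the disjoint union of the sets
  \<open>ideal_seqs P r k I\<close> over all ideals \<open>I\<close>, that is, the index set of the
  whole right-hand side.\<close>

definition ideal_chains :: "'a set \<Rightarrow> 'a rel \<Rightarrow> nat \<Rightarrow> (nat \<Rightarrow> 'a set) set" where
  "ideal_chains P r k =
     {F \<in> {0..k} \<rightarrow>\<^sub>E ideals P r. F 0 = {} \<and> (\<forall>j<k. F j \<subseteq> F (Suc j))}"

text \<open>For \<open>i\<close> in \<open>{1..k}\<close> neither subtraction truncates. At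
  \<open>i = k\<close> the removed set is \<open>F 0\<close>, which is empty for an ideal
  chain.\<close>

definition chain_antichain :: "'a rel \<Rightarrow> nat \<Rightarrow> (nat \<Rightarrow> 'a set) \<Rightarrow> (nat \<times> 'a) set" where
  "chain_antichain r k F =
     (SIGMA i:{1..k}. max_elems r (F (Suc k - i)) - F (k - i))"

text \<open>The member at \<open>j\<close> is the fibre over \<open>Suc k - j\<close> of the ideal
  generated by \<open>A\<close>; the bound on \<open>i\<close> is \<open>Suc k - j \<le> i\<close>
  written without subtraction. Restricting to \<open>{0..k}\<close> makes the function extensional,
  as the encoding of ideal chains demands.\<close>

definition antichain_chain ::
    "'a set \<Rightarrow> 'a rel \<Rightarrow> nat \<Rightarrow> (nat \<times> 'a) set \<Rightarrow> nat \<Rightarrow> 'a set" where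
  "antichain_chain P r k A =
     (\<lambda>j\<in>{0..k}. {b \<in> P. \<exists>i a. (i, a) \<in> A \<and> Suc k \<le> i + j \<and> (b, a) \<in> r})"

lemma finite_ideals: "finite P \<Longrightarrow> finite (ideals P r)"
  by (rule finite_subset[of _ "Pow P"]) (auto simp: ideals_def)

lemma finite_ideal_chains: "finite P \<Longrightarrow> finite (ideal_chains P r k)"
  by (rule finite_subset[of _ "{0..k} \<rightarrow>\<^sub>E ideals P r"])
     (auto simp: ideal_chains_def intro!: finite_PiE finite_ideals)

lemma ideal_chains_ideal: "F \<in> ideal_chains P r k \<Longrightarrow> j \<le> k \<Longrightarrow> F j \<in> ideals P r"
  by (auto simp: ideal_chains_def)

lemma ideal_chains_subset: "F \<in> ideal_chains P r k \<Longrightarrow> j \<le> k \<Longrightarrow> F j \<subseteq> P"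
  by (drule (1) ideal_chains_ideal) (simp add: ideals_def)

lemma ideal_chains_mono:
  assumes "F \<in> ideal_chains P r k" "i \<le> j" "j \<le> k"
  shows "F i \<subseteq> F j"
  using assms(2,3)
proof (induction j rule: dec_induct)
  case (step n)
  moreover have "F n \<subseteq> F (Suc n)"
    using step assms(1) by (auto simp: ideal_chains_def)
  ultimately show ?case by auto
qed simp

lemma mem_antichains_product_chain:
  "A \<in> antichains ({1..k} \<times> P) (product_order (chain_order k) r) \<longleftrightarrow>
     A \<subseteq> {1..k} \<times> P \<and>
     (\<forall>i a i' a'. (i, a) \<in> A \<longrightarrow> (i', a') \<in> A \<longrightarrow> i \<le> i' \<longrightarrow> (a, a') \<in> r \<longrightarrow> i = i' \<and> a = a')"
  unfolding antichains_def product_order_def chain_order_def by fastforce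

text \<open>Among the elements of \<open>I\<close> above \<open>b\<close>, one with the fewest
  elements of \<open>I\<close> above it is maximal, since a strict step up would shrink that
  up-set.\<close>

lemma max_elems_above:
  assumes "finite I" "trans r" "antisym r" "b \<in> I"
    and refl: "\<And>a. a \<in> I \<Longrightarrow> (a, a) \<in> r"
  obtains a where "a \<in> max_elems r I" "(b, a) \<in> r"
proof -
  let ?up = "\<lambda>c. {d \<in> I. (c, d) \<in> r}"
  obtain a where a: "a \<in> I" "(b, a) \<in> r"
    and least: "\<And>c. c \<in> I \<Longrightarrow> (b, c) \<in> r \<Longrightarrow> card (?up a) \<le> card (?up c)"
    using ex_has_least_nat[of "\<lambda>c. c \<in> I \<and> (b, c) \<in> r" b "\<lambda>c. card (?up c)"] assms by blast
  have "d = a" if d: "d \<in> I" "(a, d) \<in> r" for d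
  proof (rule ccontr)
    assume "d \<noteq> a"
    hence "(d, a) \<notin> r" using d assms(3) by (auto dest: antisymD)
    have bd: "(b, d) \<in> r" using a d assms(2) by (blast dest: transD)
    have sub: "?up d \<subseteq> ?up a" using d assms(2) by (blast dest: transD)
    \<comment> \<open>The up-set of \<open>d\<close> is contained in that of \<open>a\<close> and is
      at least as large by the choice of \<open>a\<close>. Equality puts \<open>a\<close> above
      \<open>d\<close>, which antisymmetry has excluded.\<close>
    have "?up d = ?up a"
      by (rule card_seteq) (use assms(1) sub least[OF d(1) bd] in auto)
    moreover have "(a, a) \<in> r" using refl a(1) .
    ultimately show False using a(1) \<open>(d, a) \<notin> r\<close> by blast
  qed
  with a show ?thesis by (intro that[of a]) (auto simp: max_elems_def)
qed

text \<open>Let \<open>(i, a)\<close> lie below \<open>(i', a')\<close>. Since the chain increases,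
  \<open>a'\<close> also lies in the fibre over \<open>i\<close>, so maximality of \<open>a\<close>
  there gives \<open>a = a'\<close>. If \<open>i < i'\<close>, this element would lie in the set
  \<open>F (k - i)\<close> removed at level \<open>i\<close>.\<close>

lemma chain_antichain_mem_antichains:
  assumes "F \<in> ideal_chains P r k"
  shows "chain_antichain r k F \<in> antichains ({1..k} \<times> P) (product_order (chain_order k) r)"
  unfolding mem_antichains_product_chain
proof (intro conjI allI impI)
  have "F (Suc k - i) \<subseteq> P" if "i \<in> {1..k}" for i
    using that by (intro ideal_chains_subset[OF assms]) auto
  thus "chain_antichain r k F \<subseteq> {1..k} \<times> P"
    by (fastforce simp: chain_antichain_def max_elems_def)
next
  fix i a i' a'
  assume x: "(i, a) \<in> chain_antichain r k F" and y: "(i', a') \<in> chain_antichain r k F"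
    and le: "i \<le> i'" "(a, a') \<in> r"
  have ik: "i \<ge> 1" "i' \<le> k" using x y by (auto simp: chain_antichain_def)
  have a': "a' \<in> F (Suc k - i')" using y by (auto simp: chain_antichain_def max_elems_def)
  also have "\<dots> \<subseteq> F (Suc k - i)" using ik le by (intro ideal_chains_mono[OF assms]) auto
  finally show eq: "a = a'" using x le by (auto simp: chain_antichain_def max_elems_def)
  show "i = i'"
  proof (rule ccontr)
    assume "i \<noteq> i'"
    hence "F (Suc k - i') \<subseteq> F (k - i)" using ik le by (intro ideal_chains_mono[OF assms]) auto
    with a' eq x show False by (auto simp: chain_antichain_def)
  qed
qed

lemma antichain_chain_mem_ideal_chains:
  assumes "trans r" "A \<subseteq> {1..k} \<times> P"
  shows "antichain_chain P r k A \<in> ideal_chains P r k"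
proof -
  have "antichain_chain P r k A j \<in> ideals P r" if "j \<le> k" for j
    using that assms(1) by (auto simp: antichain_chain_def ideals_def dest: transD)
  \<comment> \<open>The bound \<open>i \<le> k\<close> on the first coordinates of \<open>A\<close>
    makes the member at 0 empty; the members increase because the condition on \<open>i\<close>
    weakens as \<open>j\<close> grows.\<close>
  thus ?thesis
    using assms(2) by (fastforce simp: ideal_chains_def antichain_chain_def)
qed

text \<open>An antichain is recovered as the set of maximal elements of the ideal it
  generates.\<close>

lemma chain_antichain_antichain_chain:
  assumes "trans r" "antisym r" and refl: "\<And>a. a \<in> P \<Longrightarrow> (a, a) \<in> r"
    and A: "A \<in> antichains ({1..k} \<times> P) (product_order (chain_order k) r)"
  shows "chain_antichain r k (antichain_chain P r k A) = A"
proof -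
  let ?F = "antichain_chain P r k A"
  have sub: "A \<subseteq> {1..k} \<times> P"
    and anti: "\<And>i a i' a'. (i, a) \<in> A \<Longrightarrow> (i', a') \<in> A \<Longrightarrow> i \<le> i' \<Longrightarrow> (a, a') \<in> r \<Longrightarrow> i = i' \<and> a = a'"
    using A unfolding mem_antichains_product_chain by blast+
  \<comment> \<open>The descriptions of the fibre over \<open>i\<close> and of the next one differ
    only in \<open>i \<le> i'\<close> against \<open>i < i'\<close>. An element of the first fibre
    outside the second can thus only be dominated from level \<open>i\<close> itself.\<close>
  have fib: "b \<in> ?F (Suc k - i) \<longleftrightarrow> b \<in> P \<and> (\<exists>i' a. (i', a) \<in> A \<and> i \<le> i' \<and> (b, a) \<in> r)"
    if "i \<in> {1..k}" for i b
  proof -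
    have "Suc k \<le> i' + (Suc k - i) \<longleftrightarrow> i \<le> i'" for i' using that by auto
    moreover have "Suc k - i \<in> {0..k}" using that by auto
    ultimately show ?thesis by (simp add: antichain_chain_def)
  qed
  have next_fib: "b \<in> ?F (k - i) \<longleftrightarrow> b \<in> P \<and> (\<exists>i' a. (i', a) \<in> A \<and> i < i' \<and> (b, a) \<in> r)"
    if "i \<in> {1..k}" for i b
  proof -
    have "Suc k \<le> i' + (k - i) \<longleftrightarrow> i < i'" for i' using that by auto
    moreover have "k - i \<in> {0..k}" by auto
    ultimately show ?thesis by (simp add: antichain_chain_def)
  qed
  have "(i, a) \<in> chain_antichain r k ?F \<longleftrightarrow> (i, a) \<in> A" for i a
  proof
    assume x: "(i, a) \<in> chain_antichain r k ?F"
    hence i: "i \<in> {1..k}" and "a \<in> ?F (Suc k - i)" and notin: "a \<notin> ?F (k - i)"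
      and mx: "\<And>y. y \<in> ?F (Suc k - i) \<Longrightarrow> (a, y) \<in> r \<Longrightarrow> y = a"
      by (auto simp: chain_antichain_def max_elems_def)
    then obtain i' a' where a': "(i', a') \<in> A" "i \<le> i'" "(a, a') \<in> r" "a \<in> P"
      using fib by blast
    have "a' \<in> ?F (Suc k - i)" using a' sub refl fib[OF i] by blast
    hence "a' = a" using mx a' by blast
    \<comment> \<open>With \<open>i < i'\<close>, the pair \<open>(i', a')\<close> would put
      \<open>a\<close> into the next fibre.\<close>
    moreover have "i' = i" using a' notin next_fib[OF i] by (metis le_neq_implies_less)
    ultimately show "(i, a) \<in> A" using a' by simp
  next
    assume x: "(i, a) \<in> A"
    hence i: "i \<in> {1..k}" and a: "a \<in> P" using sub by auto
    have "y = a" if y: "y \<in> ?F (Suc k - i)" "(a, y) \<in> r" for y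
    proof -
      obtain i' a' where a': "(i', a') \<in> A" "i \<le> i'" "(y, a') \<in> r"
        using y fib[OF i] by blast
      \<comment> \<open>From \<open>a \<le> y \<le> a'\<close> the antichain condition identifies
        the two ends, and antisymmetry then squeezes \<open>y\<close> between them.\<close>
      hence "a = a'" using anti[OF x] y(2) assms(1) by (meson transD)
      with a' y assms(2) show ?thesis by (auto dest: antisymD)
    qed
    moreover have "a \<in> ?F (Suc k - i)" using x a fib[OF i] refl by blast
    moreover have "a \<notin> ?F (k - i)" using next_fib[OF i] anti[OF x] by fastforce
    ultimately show "(i, a) \<in> chain_antichain r k ?F"
      using i by (auto simp: chain_antichain_def max_elems_def)
  qed
  thus ?thesis by auto
qed

text \<open>The generators of level at least \<open>Suc k - j\<close> all lie in \<open>F j\<close>,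
  which is closed downwards. Conversely, each \<open>b\<close> in \<open>F j\<close> lies below a
  generator coming from the first member of the chain that contains \<open>b\<close>.\<close>

lemma antichain_chain_chain_antichain:
  assumes "finite P" "trans r" "antisym r" and refl: "\<And>a. a \<in> P \<Longrightarrow> (a, a) \<in> r"
    and F: "F \<in> ideal_chains P r k"
  shows "antichain_chain P r k (chain_antichain r k F) = F"
proof
  fix j
  show "antichain_chain P r k (chain_antichain r k F) j = F j"
  proof (cases "j \<le> k")
    case False
    thus ?thesis using F by (auto simp: antichain_chain_def ideal_chains_def PiE_def extensional_def)
  next
    case True
    have ideal: "F m \<subseteq> P" "\<And>a b. b \<in> P \<Longrightarrow> a \<in> F m \<Longrightarrow> (b, a) \<in> r \<Longrightarrow> b \<in> F m" if "m \<le> k" for m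
      using ideal_chains_ideal[OF F that] by (auto simp: ideals_def)
    have "b \<in> P \<and> (\<exists>i a. (i, a) \<in> chain_antichain r k F \<and> Suc k \<le> i + j \<and> (b, a) \<in> r)
            \<longleftrightarrow> b \<in> F j" for b
    proof safe
      fix i a
      assume b: "b \<in> P" "(b, a) \<in> r" and x: "(i, a) \<in> chain_antichain r k F" "Suc k \<le> i + j"
      have "a \<in> F (Suc k - i)" using x by (auto simp: chain_antichain_def max_elems_def)
      also have "\<dots> \<subseteq> F j" using x True by (intro ideal_chains_mono[OF F]) auto
      finally show "b \<in> F j" using ideal(2)[OF True] b by blast
    next
      assume b: "b \<in> F j"
      thus "b \<in> P" using ideal(1)[OF True] by blast
      define m where "m = (LEAST m. b \<in> F m)"
      have bm: "b \<in> F m" unfolding m_def using b by (rule LeastI)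
      have "m \<le> j" unfolding m_def using b by (rule Least_le)
      \<comment> \<open>Emptiness of \<open>F 0\<close> makes \<open>m\<close> positive, so
        \<open>m - 1\<close> is a genuine predecessor and minimality of \<open>m\<close> applies to
        it.\<close>
      have "F 0 = {}" using F by (simp add: ideal_chains_def)
      with bm have "m > 0" by (cases m) auto
      hence notin: "b \<notin> F (m - 1)" using not_less_Least[of "m - 1" "\<lambda>m. b \<in> F m"]
        by (simp add: m_def)
      have "finite (F m)"
        using ideal(1)[of m] \<open>m \<le> j\<close> True assms(1) by (auto intro: finite_subset)
      moreover have "(a, a) \<in> r" if "a \<in> F m" for a
        using that ideal(1)[of m] \<open>m \<le> j\<close> True by (intro refl) auto
      ultimately obtain a where a: "a \<in> max_elems r (F m)" "(b, a) \<in> r"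
        using max_elems_above[OF _ assms(2,3) bm] by blast
      \<comment> \<open>Otherwise \<open>b\<close>, lying below \<open>a\<close>, would already
        belong to the ideal \<open>F (m - 1)\<close>.\<close>
      have "a \<notin> F (m - 1)"
        using ideal(2)[of "m - 1" b a] \<open>b \<in> P\<close> a notin \<open>m \<le> j\<close> True by linarith
      \<comment> \<open>For the level \<open>i = Suc k - m\<close>, the indices
        \<open>Suc k - i\<close> and \<open>k - i\<close> are \<open>m\<close> and
        \<open>m - 1\<close>.\<close>
      with a \<open>m > 0\<close> \<open>m \<le> j\<close> True have "(Suc k - m, a) \<in> chain_antichain r k F"
        by (auto simp: chain_antichain_def Suc_diff_le)
      thus "\<exists>i a. (i, a) \<in> chain_antichain r k F \<and> Suc k \<le> i + j \<and> (b, a) \<in> r"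
        using a \<open>m \<le> j\<close> True by (intro exI[of _ "Suc k - m"] exI[of _ a]) auto
    qed
    thus ?thesis using True by (auto simp: antichain_chain_def)
  qed
qed

lemma card_chain_antichain:
  assumes "finite P" "F \<in> ideal_chains P r k"
  shows "card (chain_antichain r k F) = (\<Sum>j=1..k. card (max_elems r (F j) - F (j - 1)))"
proof -
  have "finite (max_elems r (F (Suc k - i)) - F (k - i))" if "i \<in> {1..k}" for i
  proof -
    have "F (Suc k - i) \<subseteq> P" using that by (intro ideal_chains_subset[OF assms(2)]) auto
    hence "max_elems r (F (Suc k - i)) \<subseteq> P" by (auto simp: max_elems_def)
    thus ?thesis using assms(1) by (auto intro: finite_subset)
  qed
  hence "card (chain_antichain r k F) =
      (\<Sum>i=1..k. card (max_elems r (F (Suc k - i)) - F (k - i)))"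
    unfolding chain_antichain_def by (intro card_SigmaI) auto
  \<comment> \<open>The substitution \<open>j = Suc k - i\<close> is an involution of
    \<open>{1..k}\<close> and turns \<open>k - i\<close> into \<open>j - 1\<close>.\<close>
  also have "\<dots> = (\<Sum>j=1..k. card (max_elems r (F j) - F (j - 1)))"
    by (rule sum.reindex_bij_witness[of _ "\<lambda>j. Suc k - j" "\<lambda>i. Suc k - i"]) auto
  finally show ?thesis .
qed

theorem mainTheorem2:
  fixes Q :: "'a set" and r :: "'a rel" and k :: nat
  assumes "finite Q" and "partial_order_on Q r"
    and "connected_poset Q r" and "graded_poset Q r"
    and "k \<ge> 1"
  shows "antichain_poly ({1..k} \<times> Q) (product_order (chain_order k) r)
           = (\<Sum>I\<in>ideals Q r. ideal_poly Q r k I)"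
proof -
  have tr: "trans r" and asym: "antisym r" and refl: "\<And>a. a \<in> Q \<Longrightarrow> (a, a) \<in> r"
    using assms(2) by (auto simp: partial_order_on_def preorder_on_def dest: refl_onD)
  let ?w = "\<lambda>F. monom (1::int) (\<Sum>j=1..k. card (max_elems r (F j) - F (j - 1)))"
  have "(\<Sum>I\<in>ideals Q r. ideal_poly Q r k I) =
      (\<Sum>I\<in>ideals Q r. \<Sum>F\<in>{F \<in> ideal_chains Q r k. F k = I}. ?w F)"
    unfolding ideal_poly_def
    by (intro sum.cong HOL.refl) (auto simp: ideal_seqs_def ideal_chains_def)
  \<comment> \<open>The chains are partitioned by their last member \<open>F k\<close>, which is
    always an ideal of \<open>Q\<close>.\<close>
  also have "\<dots> = (\<Sum>F\<in>ideal_chains Q r k. ?w F)"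
    by (rule sum.group) (auto simp: finite_ideal_chains finite_ideals assms(1) ideal_chains_ideal)
  also have "\<dots> = antichain_poly ({1..k} \<times> Q) (product_order (chain_order k) r)"
    unfolding antichain_poly_def
  \<comment> \<open>The two maps are mutually inverse, and the cardinality of the antichain is the
    exponent attached to the chain, so the sums agree term by term.\<close>
  proof (rule sum.reindex_bij_witness[of _ "antichain_chain Q r k" "chain_antichain r k"])
    fix F assume F: "F \<in> ideal_chains Q r k"
    show "antichain_chain Q r k (chain_antichain r k F) = F"
      by (rule antichain_chain_chain_antichain[OF assms(1) tr asym refl F])
    show "chain_antichain r k F \<in> antichains ({1..k} \<times> Q) (product_order (chain_order k) r)"
      by (rule chain_antichain_mem_antichains[OF F])
    show "monom 1 (card (chain_antichain r k F)) = ?w F"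
      by (simp only: card_chain_antichain[OF assms(1) F])
  next
    fix A assume A: "A \<in> antichains ({1..k} \<times> Q) (product_order (chain_order k) r)"
    show "chain_antichain r k (antichain_chain Q r k A) = A"
      by (rule chain_antichain_antichain_chain[OF tr asym refl A])
    show "antichain_chain Q r k A \<in> ideal_chains Q r k"
      using A by (intro antichain_chain_mem_ideal_chains tr) (auto simp: antichains_def)
  qed
  finally show ?thesis by simp
qed

end
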